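(* Let $(v_{12},v_{13},v_{23})\in\mathbb{Z}_{\geq 0}^3$. Then there exist lattice polytopes $P_1,P_2,P_3$ in $\mathbb{R}^2$ such that $v_{ij}=V(P_i,P_j)$ for $1\leq i<j\leq 3$. Equivalently, $$\mathcal{V}^{\rm sf}_{3,2}(\mathbb{Z})=\{v_{12}x_1x_2+v_{13}x_1x_3+v_{23}x_2x_3 : v_{ij}\in\mathbb{Z}_{\geq 0}\}.$$
   Context: A lattice polytope in $\mathbb{R}^2$ is the convex hull of a nonempty finite subset of $\mathbb{Z}^2$ (points and segments are allowed). For lattice polytopes $P,Q$ in $\mathbb{R}^2$ the normalized mixed area is $V(P,Q)=\frac12\left(\mathrm{Vol}_2(P+Q)-\mathrm{Vol}_2(P)-\mathrm{Vol}_2(Q)\right)$, where $P+Q$ is the Minkowski sum and $\mathrm{Vol}_2$ is twice the Euclidean area; it is a non-negative integer. The set $\mathcal{V}^{\rm sf}_{3,2}(\mathbb{Z})$ consists of all polynomials $\sum_{1\le i<j\le 3}V(P_i,P_j)x_ix_j$ with $P_1,P_2,P_3$ lattice polytopes in $\mathbb{R}^2$. *)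

theory Defs
  imports "HOL-Analysis.Analysis" "HOL-Library.Set_Algebras" "HOL-Library.Poly_Mapping"
begin

definition lattice_polytope :: "(real ^ 2) set \<Rightarrow> bool" where
  "lattice_polytope P \<longleftrightarrow>
     (\<exists>S. finite S \<and> S \<noteq> {} \<and> (\<forall>x\<in>S. \<forall>i. x $ i \<in> \<int>) \<and> P = convex hull S)"

definition Vol2 :: "(real ^ 2) set \<Rightarrow> real" where
  "Vol2 P = 2 * measure lebesgue P"

text \<open>In \<open>P + Q\<close>, addition of sets is the Minkowski sum of \<^theory>\<open>HOL-Library.Set_Algebras\<close>.\<close>

definition mixed_area :: "(real ^ 2) set \<Rightarrow> (real ^ 2) set \<Rightarrow> real" where
  "mixed_area P Q = (Vol2 (P + Q) - Vol2 P - Vol2 Q) / 2"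

text \<open>Multivariate real polynomials are finitely supported maps from exponent vectors
  (themselves finitely supported maps from variable indices to exponents) to coefficients;
  the product of \<^theory>\<open>HOL-Library.Poly_Mapping\<close> is then polynomial multiplication.
  The coefficients are real because \<^const>\<open>mixed_area\<close> is real-valued.\<close>

type_synonym real_mpoly = "(nat \<Rightarrow>\<^sub>0 nat) \<Rightarrow>\<^sub>0 real"

definition Cst :: "real \<Rightarrow> real_mpoly" where
  "Cst c = Poly_Mapping.single 0 c"

definition Var :: "nat \<Rightarrow> real_mpoly" where
  "Var i = Poly_Mapping.single (Poly_Mapping.single i 1) 1"

text \<open>The set \<open>\<V>\<^sup>s\<^sup>f\<^sub>n\<^sub>,\<^sub>2(\<int>)\<close>; polytopes and variables are indexed by \<open>{1..n}\<close>.\<close>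

definition Vsf2 :: "nat \<Rightarrow> real_mpoly set" where
  "Vsf2 n =
     {\<Sum>(i, j)\<in>{(i, j). 1 \<le> i \<and> i < j \<and> j \<le> n}. Cst (mixed_area (P i) (P j)) * Var i * Var j
       | P :: nat \<Rightarrow> (real ^ 2) set. \<forall>i\<in>{1..n}. lattice_polytope (P i)}"

end

(*
  Existence. For b <= a <= c with b > 0 write c = s b + t with 0 <= t < b. The segments [0, e1] and
  [0, (-1, b)] and the triangle with vertices 0, (0, a), (s, t) have the mixed areas a, b, c,
  because the mixed area of P with a segment [0, v] is the length of the image of P under x |-> det(v, x).

  Integrality. For fixed K, the mixed area with K is a valuation on convex bodies. Cutting a polygon along
  diagonals reduces L to triangles and segments. For a triangle T the mixed area is a sum of three
  values of the support function of K: comparing the areas of K + n T and of a homothetic copy of T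
  circumscribed about K + n T, as n tends to infinity, bounds the mixed area from above; since T and -T
  tile a parallelogram, whose mixed area is known, the bounds for T and -T must both be equalities.
*)

theory Submission
  imports Defs
begin

section \<open>Convex bodies in the plane and elementary rules for the mixed area\<close>

definition convex_body :: "(real ^ 2) set \<Rightarrow> bool" where
  "convex_body K \<longleftrightarrow> compact K \<and> convex K \<and> K \<noteq> {}"

definition support :: "(real ^ 2) set \<Rightarrow> real ^ 2 \<Rightarrow> real" where
  "support K u = Sup ((\<lambda>x. u \<bullet> x) ` K)"

abbreviation e1 :: "real ^ 2" where "e1 \<equiv> axis 1 1"
abbreviation e2 :: "real ^ 2" where "e2 \<equiv> axis 2 1"

text \<open>Counterclockwise quarter turn. Then \<open>rot v \<bullet> x\<close> is the determinant
  of \<open>v\<close> and \<open>x\<close>, so its sign tells on which side of the line through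
  \<open>0\<close> and \<open>v\<close> the point \<open>x\<close> lies.\<close>

definition rot :: "real ^ 2 \<Rightarrow> real ^ 2" where
  "rot v = vector [- (v $ 2), v $ 1]"

lemma inner_2: "(x :: real ^ 2) \<bullet> y = x $ 1 * y $ 1 + x $ 2 * y $ 2"
  by (simp add: inner_vec_def sum_2)

lemma vec2_eq_iff: "(x :: real ^ 2) = y \<longleftrightarrow> x $ 1 = y $ 1 \<and> x $ 2 = y $ 2"
  by (simp add: vec_eq_iff forall_2)

lemma mem_cbox_2: "(x :: real ^ 2) \<in> cbox a b \<longleftrightarrow>
    a $ 1 \<le> x $ 1 \<and> x $ 1 \<le> b $ 1 \<and> a $ 2 \<le> x $ 2 \<and> x $ 2 \<le> b $ 2"
  by (auto simp: mem_box_cart forall_2)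

lemma content_cbox_2:
  assumes "a $ 1 \<le> b $ 1" "a $ 2 \<le> b $ 2"
  shows "measure lborel (cbox a b) = (b $ 1 - a $ 1) * (b $ 2 - (a :: real ^ 2) $ 2)"
proof -
  have "cbox a b \<noteq> {}"
    using assms by (metis empty_iff mem_cbox_2 order_refl)
  then show ?thesis by (simp add: content_cbox_cart prod_2 UNIV_2)
qed

lemma axis_nth_2 [simp]: "e1 $ 1 = 1" "e1 $ 2 = 0" "e2 $ 1 = 0" "e2 $ 2 = 1"
  by (auto simp: axis_def)

lemma rot_nth [simp]: "rot v $ 1 = - (v $ 2)" "rot v $ 2 = v $ 1"
  by (simp_all add: rot_def)

lemma mixed_area_eq:
  "mixed_area P Q = measure lebesgue (P + Q) - measure lebesgue P - measure lebesgue Q"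
  by (simp add: mixed_area_def Vol2_def)

lemma mixed_area_commute: "mixed_area P Q = mixed_area Q P"
  by (simp add: mixed_area_eq add.commute)

lemma convex_body_lmeasurable: "convex_body K \<Longrightarrow> K \<in> lmeasurable"
  by (simp add: convex_body_def lmeasurable_compact)

lemma convex_body_plus:
  assumes "convex_body K" "convex_body L"
  shows "convex_body (K + L)"
proof -
  have "K + L = {x + y |x y. x \<in> K \<and> y \<in> L}" by (auto simp: set_plus_def)
  then have "compact (K + L)" using assms compact_sums[of K L] by (simp add: convex_body_def)
  then show ?thesis using assms by (auto simp: convex_body_def convex_set_plus)
qed

lemma convex_body_cbox: "cbox a b \<noteq> {} \<Longrightarrow> convex_body (cbox a b)"
  by (simp add: convex_body_def)

lemma convex_body_translation: "convex_body K \<Longrightarrow> convex_body ((+) a ` K)"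
  by (auto simp: convex_body_def compact_translation convex_translation)

lemma convex_body_linear_image: "linear f \<Longrightarrow> convex_body K \<Longrightarrow> convex_body (f ` K)"
  by (auto simp: convex_body_def convex_linear_image compact_continuous_image
      linear_continuous_on linear_linear)

lemma convex_body_convex_hull: "finite S \<Longrightarrow> S \<noteq> {} \<Longrightarrow> convex_body (convex hull S)"
  by (auto simp: convex_body_def finite_imp_compact_convex_hull)

lemma mixed_area_translation: "mixed_area K ((+) a ` L) = mixed_area K L"
proof -
  have "K + (+) a ` L = (+) a ` (K + L)"
    by (force simp: set_plus_def image_def algebra_simps)
  then show ?thesis by (simp add: mixed_area_eq measure_translation)
qed

text \<open>A linear map commutes with Minkowski addition, and all three areas scale by the absolute
  value of its determinant.\<close>

lemma mixed_area_linear_image: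
  assumes "linear f" "convex_body K" "convex_body L"
  shows "mixed_area (f ` K) (f ` L) = \<bar>det (matrix f)\<bar> * mixed_area K L"
proof -
  have "f ` K + f ` L = f ` (K + L)"
    using linear_add[OF assms(1)] by (force simp: set_plus_def image_def)
  then show ?thesis
    using assms by (simp add: mixed_area_eq measure_linear_image convex_body_lmeasurable
        convex_body_plus algebra_simps)
qed

lemma mixed_area_singleton: "mixed_area K {a} = 0"
proof -
  have "K + {a} = (+) a ` K" by (auto simp: set_plus_def image_def algebra_simps)
  then show ?thesis by (simp add: mixed_area_eq measure_translation)
qed

section \<open>Support functions\<close>

lemma support_attained:
  assumes "convex_body K"
  obtains x where "x \<in> K" "u \<bullet> x = support K u" "\<And>y. y \<in> K \<Longrightarrow> u \<bullet> y \<le> support K u"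
proof -
  have "continuous_on K (\<lambda>x. u \<bullet> x)" by (intro continuous_intros)
  then obtain x where x: "x \<in> K" "\<And>y. y \<in> K \<Longrightarrow> u \<bullet> y \<le> u \<bullet> x"
    using assms continuous_attains_sup[of K "\<lambda>x. u \<bullet> x"] by (auto simp: convex_body_def)
  then have "support K u = u \<bullet> x"
    unfolding support_def by (intro cSup_eq_maximum) auto
  with x that show ?thesis by simp
qed

lemma support_upper: "convex_body K \<Longrightarrow> y \<in> K \<Longrightarrow> u \<bullet> y \<le> support K u"
  by (metis support_attained)

lemma support_plus:
  assumes "convex_body K" "convex_body L"
  shows "support (K + L) u = support K u + support L u"
proof -
  obtain x where x: "x \<in> K" "u \<bullet> x = support K u" by (metis support_attained assms(1))
  obtain y where y: "y \<in> L" "u \<bullet> y = support L u" by (metis support_attained assms(2))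
  show ?thesis
    unfolding support_def[of "K + L"]
  proof (rule cSup_eq_maximum)
    show "support K u + support L u \<in> (\<bullet>) u ` (K + L)"
      using x y by (force simp: set_plus_def inner_add_right image_def)
    show "z \<le> support K u + support L u" if "z \<in> (\<bullet>) u ` (K + L)" for z
      using that assms by (auto simp: set_plus_def inner_add_right intro!: add_mono support_upper)
  qed
qed

text \<open>For linear \<open>f\<close> the hypothesis says that the adjoint of \<open>f\<close>
  sends \<open>u\<close> to \<open>w\<close>.\<close>

lemma support_image: "(\<And>x. u \<bullet> f x = w \<bullet> x) \<Longrightarrow> support (f ` K) u = support K w"
  by (simp add: support_def image_image)

lemma support_scaleR:
  assumes "convex_body K" "0 \<le> c"
  shows "support K (c *\<^sub>R u) = c * support K u"
proof -
  obtain x where x: "x \<in> K" "u \<bullet> x = support K u" by (metis support_attained assms(1))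
  show ?thesis
    unfolding support_def[of K "c *\<^sub>R u"] using x support_upper[OF assms(1)] \<open>0 \<le> c\<close>
    by (intro cSup_eq_maximum) (auto simp: image_def mult_left_mono intro!: bexI[of _ x])
qed

text \<open>A half-plane that contains \<open>S\<close> contains its hull, so passing to the hull
  does not raise the maximum.\<close>

lemma support_convex_hull:
  assumes "finite S" "S \<noteq> {}"
  shows "support (convex hull S) u = Max ((\<lambda>x. u \<bullet> x) ` S)"
  unfolding support_def
proof (rule cSup_eq_maximum)
  have "Max ((\<lambda>x. u \<bullet> x) ` S) \<in> (\<lambda>x. u \<bullet> x) ` S" using assms by simp
  then show "Max ((\<lambda>x. u \<bullet> x) ` S) \<in> (\<lambda>x. u \<bullet> x) ` (convex hull S)"
    using hull_subset[of S convex] by blast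
  have "S \<subseteq> {x. u \<bullet> x \<le> Max ((\<lambda>x. u \<bullet> x) ` S)}" using assms by auto
  then have "convex hull S \<subseteq> {x. u \<bullet> x \<le> Max ((\<lambda>x. u \<bullet> x) ` S)}"
    by (intro hull_minimal convex_halfspace_le)
  then show "z \<le> Max ((\<lambda>x. u \<bullet> x) ` S)" if "z \<in> (\<lambda>x. u \<bullet> x) ` (convex hull S)" for z
    using that by auto
qed

section \<open>The valuation property\<close>

text \<open>If \<open>x = p + a = q + b\<close>, then for every \<open>t\<close> the point
  \<open>x\<close> is also the sum of the convex combinations of \<open>p\<close>, \<open>q\<close>
  and of \<open>a\<close>, \<open>b\<close> with parameter \<open>t\<close>. The segment from
  \<open>a\<close> to \<open>b\<close> stays in \<open>A \<union> B\<close>, so some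
  \<open>t\<close> gives a point of \<open>A \<inter> B\<close>.\<close>

lemma set_plus_Int_convex:
  fixes K :: "'a :: real_normed_vector set"
  assumes "convex K" "closed A" "closed B" "convex (A \<union> B)"
  shows "(K + A) \<inter> (K + B) = K + (A \<inter> B)"
proof
  show "K + (A \<inter> B) \<subseteq> (K + A) \<inter> (K + B)" by (auto simp: set_plus_def)
  show "(K + A) \<inter> (K + B) \<subseteq> K + (A \<inter> B)"
  proof
    fix x assume "x \<in> (K + A) \<inter> (K + B)"
    then obtain p a q b where *: "p \<in> K" "a \<in> A" "q \<in> K" "b \<in> B" "x = p + a" "x = q + b"
      by (auto simp: set_plus_def)
    have "closed_segment a b \<subseteq> A \<union> B"
      using * assms(4) by (intro closed_segment_subset) auto
    \<comment> \<open>A connected segment covered by two closed sets, each containing one of its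
      ends, meets their intersection.\<close>
    then have "A \<inter> B \<inter> closed_segment a b \<noteq> {}"
      using * assms(2,3) connected_segment(1)[of a b, unfolded connected_closed]
      by (metis (lifting) Int_iff empty_iff ends_in_segment)
    then obtain t where t: "0 \<le> t" "t \<le> 1" "(1 - t) *\<^sub>R a + t *\<^sub>R b \<in> A \<inter> B"
      by (metis (no_types, lifting) Int_iff all_not_in_conv in_segment(1))
    have "(1 - t) *\<^sub>R p + t *\<^sub>R q \<in> K"
      using * t assms(1) by (intro convexD) auto
    moreover have "x = ((1 - t) *\<^sub>R p + t *\<^sub>R q) + ((1 - t) *\<^sub>R a + t *\<^sub>R b)"
    proof -
      have "x = (1 - t) *\<^sub>R x + t *\<^sub>R x" by (simp add: algebra_simps)
      also have "\<dots> = (1 - t) *\<^sub>R (p + a) + t *\<^sub>R (q + b)" using * by simp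
      finally show ?thesis by (simp add: algebra_simps)
    qed
    ultimately show "x \<in> K + (A \<inter> B)" using t(3) by (auto simp: set_plus_def)
  qed
qed

lemma measure_Un_Int:
  assumes "A \<in> lmeasurable" "B \<in> lmeasurable"
  shows "measure lebesgue (A \<union> B) + measure lebesgue (A \<inter> B) = measure lebesgue A + measure lebesgue B"
  using measure_Un3[OF assms] by simp

text \<open>Inclusion-exclusion for area holds for \<open>A\<close>, \<open>B\<close> and also for
  \<open>K + A\<close>, \<open>K + B\<close>, because convexity of the union makes
  \<open>K + (A \<inter> B)\<close> the intersection of the latter two. The area of \<open>K\<close>
  occurs twice on each side.\<close>

lemma mixed_area_valuation:
  assumes "convex_body K" "convex_body A" "convex_body B" "convex (A \<union> B)"
  shows "mixed_area K (A \<union> B) + mixed_area K (A \<inter> B) = mixed_area K A + mixed_area K B"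
proof -
  have "(K + A) \<inter> (K + B) = K + (A \<inter> B)"
    using assms by (intro set_plus_Int_convex) (auto simp: convex_body_def compact_imp_closed)
  moreover have "(K + A) \<union> (K + B) = K + (A \<union> B)" by (auto simp: set_plus_def)
  ultimately have "measure lebesgue (K + (A \<union> B)) + measure lebesgue (K + (A \<inter> B))
      = measure lebesgue (K + A) + measure lebesgue (K + B)"
    using measure_Un_Int[of "K + A" "K + B"] assms
    by (simp add: convex_body_plus convex_body_lmeasurable)
  then show ?thesis
    using measure_Un_Int[of A B] assms by (simp add: mixed_area_eq convex_body_lmeasurable)
qed

text \<open>Associativity of the Minkowski sum. It reduces additivity in the second argument to
  additivity in the first argument against \<open>B\<close>, which for a segment \<open>B\<close>
  can be read off the support function.\<close>

lemma mixed_area_add: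
  "mixed_area K (A + B) = mixed_area K A + mixed_area (K + A) B - mixed_area A B"
  by (simp add: mixed_area_eq add.assoc)

text \<open>Used to compare the terms linear in \<open>n\<close> of two area estimates that differ
  by a bounded amount.\<close>

lemma nonpos_if_multiples_bounded:
  assumes "\<And>n :: nat. real n * a \<le> C"
  shows "a \<le> 0"
proof (rule ccontr)
  assume "\<not> a \<le> 0"
  then obtain n where "C < real n * a" using reals_Archimedean3[of a] by auto
  with assms[of n] show False by simp
qed

section \<open>Mixed area with a segment\<close>

text \<open>The degenerate boxes are horizontal segments. Two that abut meet in one point, whose
  mixed area with \<open>K\<close> is zero, so the valuation property gives additivity.\<close>

lemma mixed_area_add_interval:
  assumes "convex_body K" "0 \<le> s" "0 \<le> t"
  shows "mixed_area K (cbox 0 (vector [s + t, 0])) =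
    mixed_area K (cbox 0 (vector [s, 0])) + mixed_area K (cbox 0 (vector [t, 0]))"
proof -
  let ?A = "cbox 0 (vector [s, 0]) :: (real ^ 2) set"
  let ?B = "(+) (vector [s, 0]) ` cbox 0 (vector [t, 0]) :: (real ^ 2) set"
  have B: "?B = cbox (vector [s, 0]) (vector [s + t, 0])"
    unfolding cbox_translation[symmetric] by (rule arg_cong2[where f = cbox]) (simp_all add: vec2_eq_iff)
  have U: "?A \<union> ?B = cbox 0 (vector [s + t, 0])" and I: "?A \<inter> ?B = {vector [s, 0]}"
    using assms by (auto simp: B set_eq_iff mem_cbox_2 vec2_eq_iff)
  have "convex_body ?A" "convex_body ?B"
    using assms unfolding B
    by (auto intro!: convex_body_cbox ex_in_conv[THEN iffD1] exI[of _ "vector [s, 0]"] simp: mem_cbox_2)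
  then show ?thesis
    using mixed_area_valuation[of K ?A ?B] assms U I
    by (simp add: mixed_area_singleton mixed_area_translation)
qed

text \<open>By additivity the area of \<open>K + ?I n\<close> is the area of \<open>K\<close> plus
  \<open>n * ?f\<close>. A bounding box bounds this area from above and an inscribed parallelogram
  from below, both with leading term \<open>n * ?W\<close>; large \<open>n\<close> forces
  \<open>?f = ?W\<close>.\<close>

lemma mixed_area_unit_segment:
  assumes "convex_body K"
  shows "mixed_area K (cbox 0 e1) = support K e2 + support K (- e2)" (is "?f = ?W")
proof -
  let ?I = "\<lambda>n. cbox 0 (vector [real n, 0]) :: (real ^ 2) set"
  define X where "X = support K e1 + support K (- e1)"
  have e1: "vector [1, 0] = e1" by (simp add: vec2_eq_iff)
  have I: "mixed_area K (?I n) = n * ?f" for n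
  proof (induction n)
    case 0
    have "?I 0 = {0}" by (auto simp: mem_cbox_2 vec2_eq_iff)
    then show ?case by (simp add: mixed_area_singleton)
  next
    case (Suc n)
    then show ?case
      using mixed_area_add_interval[OF assms, of n 1] by (simp add: e1 algebra_simps)
  qed
  have m: "measure lebesgue (K + ?I n) = measure lebesgue K + n * ?f" for n
    using I[of n] by (simp add: mixed_area_eq content_cbox_2)
  have bodyI: "convex_body (?I n)" for n
    by (rule convex_body_cbox) (metis mem_cbox_2 empty_iff of_nat_0_le_iff order_refl vector_2 zero_index)
  \<comment> \<open>\<open>p\<close> is a highest and \<open>q\<close> a lowest point of
    \<open>K\<close>, so \<open>?W\<close> is the height of \<open>K\<close>.\<close>
  obtain p where p: "p \<in> K" "e2 \<bullet> p = support K e2" by (metis support_attained assms)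
  obtain q where q: "q \<in> K" "- e2 \<bullet> q = support K (- e2)" by (metis support_attained assms)
  have W: "?W = p $ 2 - q $ 2" using p q by (simp add: inner_2)
  have "0 \<le> ?W" using p q support_upper[OF assms p(1), of "-e2"] by (simp add: inner_2)
  have upper: "measure lebesgue (K + ?I n) \<le> (X + n) * ?W" for n
  proof -
    let ?R = "cbox (vector [- support K (- e1), - support K (- e2)]) (vector [support K e1 + n, support K e2]) :: (real ^ 2) set"
    have "K + ?I n \<subseteq> ?R"
    proof
      fix x assume "x \<in> K + ?I n"
      then obtain k y where *: "k \<in> K" "y \<in> ?I n" "x = k + y" by (auto simp: set_plus_def)
      then show "x \<in> ?R"
        using support_upper[OF assms *(1), of e1] support_upper[OF assms *(1), of "-e1"]
          support_upper[OF assms *(1), of e2] support_upper[OF assms *(1), of "-e2"]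
        by (auto simp: mem_cbox_2 inner_2)
    qed
    then have "measure lebesgue (K + ?I n) \<le> measure lebesgue ?R"
      by (intro measure_mono_fmeasurable)
        (auto intro: fmeasurableD convex_body_lmeasurable convex_body_plus assms bodyI)
    also have "\<dots> = (X + n) * ?W"
    proof -
      have "0 \<le> X" using support_upper[OF assms p(1), of "e1"] support_upper[OF assms p(1), of "-e1"]
        by (simp add: X_def inner_2)
      then show ?thesis
        using \<open>0 \<le> ?W\<close> by (simp add: content_cbox_2 X_def)
    qed
    finally show ?thesis .
  qed
  have lower: "n * ?W \<le> measure lebesgue (K + ?I n)" for n
  proof -
    \<comment> \<open>The columns of \<open>M\<close> are \<open>(n, 0)\<close> and
      \<open>p - q\<close>, so \<open>?P\<close> is the segment from \<open>q\<close> to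
      \<open>p\<close> swept along \<open>?I n\<close>, a parallelogram of area
      \<open>n * ?W\<close>.\<close>
    define M :: "real ^ 2 ^ 2" where "M = vector [vector [n, p $ 1 - q $ 1], vector [0, p $ 2 - q $ 2]]"
    have Mv: "(M *v x) $ 1 = n * x $ 1 + (p $ 1 - q $ 1) * x $ 2" "(M *v x) $ 2 = (p $ 2 - q $ 2) * x $ 2" for x
      by (simp_all add: M_def matrix_vector_mult_def sum_2)
    let ?P = "(+) q ` ((*v) M ` cbox 0 (vector [1, 1]))"
    have "?P \<subseteq> K + ?I n"
    proof
      fix x assume "x \<in> ?P"
      then obtain y where y: "0 \<le> y $ 1" "y $ 1 \<le> 1" "0 \<le> y $ 2" "y $ 2 \<le> 1" "x = q + M *v y"
        by (auto simp: mem_cbox_2)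
      have "(1 - y $ 2) *\<^sub>R q + y $ 2 *\<^sub>R p \<in> K"
        using y p(1) q(1) assms by (intro convexD) (auto simp: convex_body_def)
      moreover have "vector [n * y $ 1, 0] \<in> ?I n"
        using y by (simp add: mem_cbox_2 mult_left_le)
      moreover have "x = ((1 - y $ 2) *\<^sub>R q + y $ 2 *\<^sub>R p) + vector [n * y $ 1, 0]"
        by (simp add: vec2_eq_iff Mv y algebra_simps)
      ultimately show "x \<in> K + ?I n" by (auto simp: set_plus_def)
    qed
    then have "measure lebesgue ?P \<le> measure lebesgue (K + ?I n)"
      by (intro measure_mono_fmeasurable)
        (auto intro: convex_body_lmeasurable convex_body_plus assms bodyI
          fmeasurableD[OF measurable_translation[OF measurable_linear_image]])
    moreover have "measure lebesgue ?P = n * ?W"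
      using \<open>0 \<le> ?W\<close>
      by (simp add: measure_translation measure_linear_image content_cbox_2 det_2 M_def W)
    ultimately show ?thesis by simp
  qed
  have "n * (?f - ?W) \<le> X * ?W" for n :: nat
  proof -
    have "n * ?f \<le> (X + n) * ?W"
      using upper[of n] m[of n] measure_nonneg[of lebesgue K] by linarith
    then show ?thesis by (simp add: algebra_simps)
  qed
  moreover have "n * (?W - ?f) \<le> measure lebesgue K" for n :: nat
  proof -
    have "n * ?W - n * ?f \<le> measure lebesgue K" using lower[of n] m[of n] by linarith
    then show ?thesis by (simp only: right_diff_distrib)
  qed
  ultimately show ?thesis
    using nonpos_if_multiples_bounded[of "?f - ?W" "X * ?W"]
      nonpos_if_multiples_bounded[of "?W - ?f" "measure lebesgue K"] by simp
qed

lemma convex_body_segment [simp]: "convex_body (closed_segment a b)"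
  by (simp add: convex_body_def)

text \<open>The body \<open>K'\<close> is \<open>K\<close> in the coordinates of the basis \<open>v\<close>, \<open>w\<close>.\<close>

lemma mixed_area_change_basis:
  assumes "convex_body K" "convex_body L"
    and D: "D = v $ 1 * w $ 2 - v $ 2 * w $ 1" "0 < D"
  obtains K' where "convex_body K'"
    "mixed_area K ((\<lambda>x. x $ 1 *\<^sub>R v + x $ 2 *\<^sub>R w) ` L) = D * mixed_area K' L"
    "\<And>u. D * support K' u = support K (u $ 2 *\<^sub>R rot v - u $ 1 *\<^sub>R rot w)"
proof -
  let ?F = "\<lambda>x :: real ^ 2. x $ 1 *\<^sub>R v + x $ 2 *\<^sub>R w"
  \<comment> \<open>Cramer's rule: \<open>?G\<close> inverts \<open>?F\<close>, whose determinant is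
    \<open>D\<close>.\<close>
  let ?G = "\<lambda>x. vector [(w $ 2 * x $ 1 - w $ 1 * x $ 2) / D, (v $ 1 * x $ 2 - v $ 2 * x $ 1) / D] :: real ^ 2"
  have F: "linear ?F" by (intro linearI) (simp_all add: algebra_simps)
  have G: "linear ?G" using D(2) by (intro linearI) (simp_all add: vec2_eq_iff field_simps)
  have det: "det (matrix ?F) = D" by (simp add: det_2 matrix_def D algebra_simps)
  have FG: "?F (?G x) = x" for x
  proof -
    have "(v $ 1 * w $ 2 - v $ 2 * w $ 1) * inverse D = 1" using D by simp
    then show ?thesis
      unfolding vec2_eq_iff vector_add_component vector_scaleR_component vector_2 divide_inverse
      by (simp only: real_scaleR_def) algebra
  qed
  have body: "convex_body (?G ` K)" by (intro convex_body_linear_image G assms)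
  show ?thesis
  proof
    have "K = ?F ` (?G ` K)" unfolding image_image FG by simp
    then show "mixed_area K (?F ` L) = D * mixed_area (?G ` K) L"
      using mixed_area_linear_image[OF F body assms(2)] det D(2) by (simp only: abs_of_pos)
    show "D * support (?G ` K) u = support K (u $ 2 *\<^sub>R rot v - u $ 1 *\<^sub>R rot w)" for u
    proof -
      \<comment> \<open>Multiplying by \<open>D\<close> clears the denominators of
        \<open>?G\<close>; the adjoint of \<open>D\<close> times \<open>?G\<close> sends
        \<open>u\<close> to the stated combination of \<open>rot v\<close> and
        \<open>rot w\<close>.\<close>
      have "D * support (?G ` K) u = support (?G ` K) (D *\<^sub>R u)"
        using D(2) body by (simp only: support_scaleR less_imp_le)
      also have "\<dots> = support K (u $ 2 *\<^sub>R rot v - u $ 1 *\<^sub>R rot w)"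
        using D(2) by (intro support_image) (simp add: inner_2 field_simps)
      finally show ?thesis .
    qed
  qed (rule body)
qed

text \<open>In the basis \<open>v\<close>, \<open>rot v\<close> the segment becomes the unit segment
  on the first axis. The determinant \<open>D\<close> is the squared length of \<open>v\<close>, and
  it is absorbed when the support values are carried back to \<open>K\<close>. The case
  \<open>v = 0\<close> has no such basis.\<close>

lemma mixed_area_segment:
  assumes "convex_body K"
  shows "mixed_area K (closed_segment 0 v) = support K (rot v) + support K (- rot v)"
proof (cases "v = 0")
  case True
  have "rot 0 = 0" by (simp add: vec2_eq_iff)
  moreover have "support K 0 = 0"
    using assms by (auto simp: support_def convex_body_def)
  ultimately show ?thesis using True by (simp add: mixed_area_singleton)
next
  case False
  define D where "D = v $ 1 * rot v $ 2 - v $ 2 * rot v $ 1"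
  have D: "D > 0"
    using False unfolding D_def by (metis inner_2 inner_gt_zero_iff minus_mult_right diff_minus_eq_add rot_nth)
  have body: "convex_body (cbox 0 e1)"
    by (metis convex_body_cbox empty_iff mem_cbox_2 axis_nth_2(1,2) order_refl zero_index zero_le_one)
  obtain K' where K': "convex_body K'"
    "mixed_area K ((\<lambda>x. x $ 1 *\<^sub>R v + x $ 2 *\<^sub>R rot v) ` cbox 0 e1) = D * mixed_area K' (cbox 0 e1)"
    "\<And>u. D * support K' u = support K (u $ 2 *\<^sub>R rot v - u $ 1 *\<^sub>R rot (rot v))"
    using mixed_area_change_basis[OF assms body D_def D] by blast
  have "closed_segment 0 v = (\<lambda>x. x $ 1 *\<^sub>R v + x $ 2 *\<^sub>R rot v) ` cbox 0 e1"
  proof safe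
    fix y assume "y \<in> closed_segment 0 v"
    then obtain t where "0 \<le> t" "t \<le> 1" "y = t *\<^sub>R v" by (auto simp: in_segment)
    then show "y \<in> (\<lambda>x. x $ 1 *\<^sub>R v + x $ 2 *\<^sub>R rot v) ` cbox 0 e1"
      by (intro image_eqI[of _ _ "vector [t, 0]"]) (auto simp: mem_cbox_2)
  qed (auto simp: mem_cbox_2 in_segment)
  then show ?thesis
    using K' by (simp add: mixed_area_unit_segment distrib_left)
qed

lemma mixed_area_add_segment:
  assumes "convex_body K" "convex_body L"
  shows "mixed_area K (L + closed_segment 0 v) = mixed_area K L + mixed_area K (closed_segment 0 v)"
  using assms by (simp add: mixed_area_add mixed_area_segment convex_body_plus support_plus)

section \<open>Mixed area with a triangle\<close>

text \<open>Given by inequalities so that cutting it is linear arithmetic.\<close>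

definition std_triangle :: "real \<Rightarrow> (real ^ 2) set" where
  "std_triangle t = {x. 0 \<le> x $ 1 \<and> 0 \<le> x $ 2 \<and> x $ 1 + x $ 2 \<le> t}"

lemma mem_translation: "(x :: real ^ 2) \<in> (+) a ` S \<longleftrightarrow> x - a \<in> S"
  by (auto intro: image_eqI[of _ _ "x - a"])

lemma std_triangle_eq_hull:
  assumes "0 \<le> t"
  shows "std_triangle t = convex hull {0, vector [t, 0], vector [0, t]}"
proof safe
  fix x assume "x \<in> std_triangle t"
  then have x: "0 \<le> x $ 1" "0 \<le> x $ 2" "x $ 1 + x $ 2 \<le> t" by (auto simp: std_triangle_def)
  show "x \<in> convex hull {0, vector [t, 0], vector [0, t]}"
  proof (cases "t = 0")
    case True
    then have "x = 0" using x by (simp add: vec2_eq_iff)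
    then show ?thesis by (simp add: hull_inc)
  next
    case False
    then show ?thesis using x assms unfolding convex_hull_3
      by (intro CollectI exI[of _ "1 - (x $ 1 + x $ 2) / t"] exI[of _ "x $ 1 / t"] exI[of _ "x $ 2 / t"])
        (auto simp: vec2_eq_iff field_simps)
  qed
next
  fix x :: "real ^ 2" assume "x \<in> convex hull {0, vector [t, 0], vector [0, t]}"
  then obtain u v w :: real where "0 \<le> u" "0 \<le> v" "0 \<le> w" "u + v + w = 1"
    "x = u *\<^sub>R 0 + v *\<^sub>R vector [t, 0] + w *\<^sub>R vector [0, t]"
    unfolding convex_hull_3 by blast
  moreover from this have "(v + w) * t \<le> 1 * t" using assms by (intro mult_right_mono) auto
  ultimately show "x \<in> std_triangle t"
    using assms by (simp add: std_triangle_def algebra_simps)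
qed

lemma convex_body_std_triangle: "0 \<le> t \<Longrightarrow> convex_body (std_triangle t)"
  by (simp add: std_triangle_eq_hull convex_body_convex_hull)

lemma measure_std_triangle:
  assumes "0 \<le> t"
  shows "measure lebesgue (std_triangle t) = t\<^sup>2 / 2"
proof -
  have "std_triangle t \<in> sets lborel"
    using convex_body_std_triangle[OF assms] by (simp add: convex_body_def borel_compact)
  then show ?thesis
    using assms content_triangle[of 0 "vector [t, 0]" "vector [0, t]"]
    by (simp add: std_triangle_eq_hull power2_eq_square abs_mult measure_completion)
qed

text \<open>This makes additivity over segments applicable to boxes.\<close>

lemma rectangle_eq_segment_plus:
  assumes "0 \<le> s" "0 \<le> t"
  shows "cbox 0 (vector [s, t]) = closed_segment 0 (vector [s, 0]) + closed_segment 0 (vector [0, t] :: real ^ 2)"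
proof safe
  fix x :: "real ^ 2" assume "x \<in> cbox 0 (vector [s, t])"
  then have x: "0 \<le> x $ 1" "x $ 1 \<le> s" "0 \<le> x $ 2" "x $ 2 \<le> t" by (auto simp: mem_cbox_2)
  have "vector [x $ 1, 0] \<in> closed_segment 0 (vector [s, 0] :: real ^ 2)"
    using x by (cases "s = 0") (auto simp: in_segment vec2_eq_iff intro!: exI[of _ "x $ 1 / s"])
  moreover have "vector [0, x $ 2] \<in> closed_segment 0 (vector [0, t] :: real ^ 2)"
    using x by (cases "t = 0") (auto simp: in_segment vec2_eq_iff intro!: exI[of _ "x $ 2 / t"])
  moreover have "x = vector [x $ 1, 0] + vector [0, x $ 2]" by (simp add: vec2_eq_iff)
  ultimately show "x \<in> closed_segment 0 (vector [s, 0]) + closed_segment 0 (vector [0, t])"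
    by (auto simp: set_plus_def)
qed (use assms in \<open>auto simp: set_plus_def in_segment mem_cbox_2 mult_left_le_one_le\<close>)

lemma rectangle_body:
  assumes "0 \<le> s" "0 \<le> t"
  shows "convex_body (cbox 0 (vector [s, t]))"
  by (simp add: rectangle_eq_segment_plus assms convex_body_plus)

lemma mixed_area_rectangle:
  assumes "convex_body K" "0 \<le> s" "0 \<le> t"
  shows "mixed_area K (cbox 0 (vector [s, t])) =
    s * (support K e2 + support K (- e2)) + t * (support K e1 + support K (- e1))"
proof -
  have "rot (vector [s, 0]) = s *\<^sub>R e2" "- rot (vector [s, 0]) = s *\<^sub>R - e2"
    "rot (vector [0, t]) = t *\<^sub>R - e1" "- rot (vector [0, t]) = t *\<^sub>R e1"
    by (simp_all add: vec2_eq_iff)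
  then have r: "support K (rot (vector [s, 0])) = s * support K e2"
    "support K (- rot (vector [s, 0])) = s * support K (- e2)"
    "support K (rot (vector [0, t])) = t * support K (- e1)"
    "support K (- rot (vector [0, t])) = t * support K e1"
    using assms support_scaleR by metis+
  show ?thesis
    unfolding rectangle_eq_segment_plus[OF assms(2,3)]
    using assms by (simp add: mixed_area_add_segment mixed_area_segment r algebra_simps)
qed

text \<open>The line \<open>x $ 1 = 1\<close> cuts the triangle of size \<open>n + 1\<close> into
  the strip \<open>A\<close> and a translate \<open>B\<close> of the triangle of size
  \<open>n\<close>; the line \<open>x $ 2 = n\<close> cuts \<open>A\<close> into the rectangle
  \<open>C\<close> and a translate \<open>E\<close> of the unit triangle. The two cuts are
  translates of the sides of \<open>C\<close>, so their mixed areas add up to that of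
  \<open>C\<close> and cancel it.\<close>

lemma mixed_area_std_triangle_Suc:
  assumes K: "convex_body K"
  shows "mixed_area K (std_triangle (real n + 1)) = mixed_area K (std_triangle n) + mixed_area K (std_triangle 1)"
proof -
  define A where "A = std_triangle (real n + 1) \<inter> {x. x $ 1 \<le> 1}"
  define B where "B = (+) e1 ` std_triangle n"
  define C :: "(real ^ 2) set" where "C = cbox 0 (vector [1, n])"
  define E where "E = (+) (vector [0, n]) ` std_triangle 1"
  have B: "x \<in> B \<longleftrightarrow> 1 \<le> x $ 1 \<and> 0 \<le> x $ 2 \<and> x $ 1 + x $ 2 \<le> real n + 1" for x
    unfolding B_def by (subst mem_translation) (auto simp: std_triangle_def)
  have E: "x \<in> E \<longleftrightarrow> 0 \<le> x $ 1 \<and> n \<le> x $ 2 \<and> x $ 1 + x $ 2 \<le> real n + 1" for x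
    unfolding E_def by (subst mem_translation) (auto simp: std_triangle_def)
  have AB: "A \<union> B = std_triangle (real n + 1)"
    by (auto simp: A_def B std_triangle_def)
  have AB': "A \<inter> B = (+) e1 ` cbox 0 (vector [0, n])"
  proof (intro set_eqI iffI)
    fix x assume "x \<in> A \<inter> B"
    then show "x \<in> (+) e1 ` cbox 0 (vector [0, n])"
      by (intro image_eqI[of _ _ "x - e1"]) (auto simp: A_def B std_triangle_def mem_cbox_2)
  qed (auto simp: A_def B std_triangle_def mem_cbox_2)
  have CE: "C \<union> E = A"
    by (auto simp: A_def E C_def mem_cbox_2 std_triangle_def)
  have CE': "C \<inter> E = (+) (vector [0, n]) ` cbox 0 (vector [1, 0])"
  proof (intro set_eqI iffI)
    fix x assume "x \<in> C \<inter> E"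
    then show "x \<in> (+) (vector [0, n]) ` cbox 0 (vector [1, 0])"
      by (intro image_eqI[of _ _ "x - vector [0, n]"]) (auto simp: C_def E std_triangle_def mem_cbox_2)
  qed (auto simp: C_def E std_triangle_def mem_cbox_2)
  have bA: "convex_body A"
  proof -
    have "0 \<in> A" by (simp add: A_def std_triangle_def)
    moreover have "closed {x :: real ^ 2. x $ 1 \<le> 1}" "convex {x :: real ^ 2. x $ 1 \<le> 1}"
      using closed_halfspace_le[of e1 1] convex_halfspace_le[of e1 1] by (simp_all add: inner_2)
    ultimately show ?thesis
      using convex_body_std_triangle[of "real n + 1"]
      by (auto simp: A_def convex_body_def convex_Int compact_Int_closed)
  qed
  have bB: "convex_body B" "convex_body E"
    by (simp_all add: B_def E_def convex_body_translation convex_body_std_triangle)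
  have bC: "convex_body C" by (simp add: C_def rectangle_body)
  have "convex (A \<union> B)"
    unfolding AB using convex_body_std_triangle[of "real n + 1"] by (simp add: convex_body_def)
  from mixed_area_valuation[OF K bA bB(1) this]
  have 1: "mixed_area K (std_triangle (real n + 1)) + mixed_area K (cbox 0 (vector [0, n])) =
      mixed_area K A + mixed_area K (std_triangle n)"
    unfolding AB AB' by (simp add: mixed_area_translation B_def)
  have "convex (C \<union> E)" unfolding CE using bA by (simp add: convex_body_def)
  from mixed_area_valuation[OF K bC bB(2) this]
  have 2: "mixed_area K A + mixed_area K (cbox 0 (vector [1, 0])) =
      mixed_area K C + mixed_area K (std_triangle 1)"
    unfolding CE CE' by (simp add: mixed_area_translation E_def)
  show ?thesis using 1 2 by (simp add: C_def mixed_area_rectangle K)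
qed

lemma mixed_area_std_triangle_of_nat:
  assumes "convex_body K"
  shows "mixed_area K (std_triangle (real n)) = n * mixed_area K (std_triangle 1)"
proof (induction n)
  case 0
  have "std_triangle 0 = {0}" by (auto simp: std_triangle_def vec2_eq_iff)
  then show ?case by (simp add: mixed_area_singleton)
next
  case (Suc n)
  then show ?case using mixed_area_std_triangle_Suc[OF assms, of n] by (simp add: algebra_simps)
qed

text \<open>\<open>?l\<close> is the size of the homothetic copy of the triangle circumscribed about
  \<open>K\<close>, so \<open>K + std_triangle n\<close> fits into a copy of size
  \<open>?l + n\<close>. In the comparison of areas the terms quadratic in \<open>n\<close> cancel,
  and the linear ones give the bound.\<close>

lemma mixed_area_std_triangle_le:
  assumes K: "convex_body K"
  shows "mixed_area K (std_triangle 1) \<le> support K (e1 + e2) + support K (- e1) + support K (- e2)"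
    (is "?f \<le> ?l")
proof -
  obtain p where "p \<in> K" using K by (auto simp: convex_body_def)
  then have "0 \<le> ?l"
    using support_upper[OF K, of p "e1 + e2"] support_upper[OF K, of p "- e1"]
      support_upper[OF K, of p "- e2"] by (simp add: inner_2)
  \<comment> \<open>The right-angled corner of the circumscribed triangle.\<close>
  let ?c = "vector [- support K (- e1), - support K (- e2)] :: real ^ 2"
  have "n * (?f - ?l) \<le> ?l\<^sup>2 / 2" for n :: nat
  proof -
    have "K + std_triangle n \<subseteq> (+) ?c ` std_triangle (?l + n)"
    proof
      fix x assume "x \<in> K + std_triangle n"
      then obtain k y where *: "k \<in> K" "y \<in> std_triangle n" "x = k + y" by (auto simp: set_plus_def)
      have "x - ?c \<in> std_triangle (?l + n)"
        using *(2,3) support_upper[OF K *(1), of "e1 + e2"] support_upper[OF K *(1), of "- e1"]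
          support_upper[OF K *(1), of "- e2"] by (simp add: std_triangle_def inner_2)
      then show "x \<in> (+) ?c ` std_triangle (?l + n)"
        by (intro image_eqI[of _ _ "x - ?c"]) auto
    qed
    then have "measure lebesgue (K + std_triangle n) \<le> measure lebesgue ((+) ?c ` std_triangle (?l + n))"
      using \<open>0 \<le> ?l\<close>
      by (intro measure_mono_fmeasurable fmeasurableD convex_body_lmeasurable convex_body_plus K
          convex_body_translation convex_body_std_triangle) auto
    also have "\<dots> = (?l + n)\<^sup>2 / 2"
      using \<open>0 \<le> ?l\<close> by (simp add: measure_translation measure_std_triangle)
    finally have "measure lebesgue K + n\<^sup>2 / 2 + n * ?f \<le> (?l + n)\<^sup>2 / 2"
      using mixed_area_std_triangle_of_nat[OF K, of n] mixed_area_eq[of K "std_triangle n"]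
      by (simp add: measure_std_triangle)
    then have "n * ?f \<le> (?l + n)\<^sup>2 / 2 - n\<^sup>2 / 2"
      using measure_nonneg[of lebesgue K] by linarith
    also have "\<dots> = ?l\<^sup>2 / 2 + n * ?l" by (simp add: power2_sum field_simps)
    finally show ?thesis by (simp add: right_diff_distrib)
  qed
  from nonpos_if_multiples_bounded[OF this] show ?thesis by simp
qed

text \<open>Negation has determinant 1 in the plane, and negating \<open>K\<close> twice gives
  \<open>K\<close> back.\<close>

lemma mixed_area_uminus: "convex_body K \<Longrightarrow> convex_body L \<Longrightarrow>
    mixed_area K (uminus ` L) = mixed_area (uminus ` K) L"
  using mixed_area_linear_image[of uminus "uminus ` K" L]
  by (simp add: image_image convex_body_linear_image linear_uminus det_2 matrix_def)

text \<open>The preceding bounds for the two halves of the unit square add up to the exact total.\<close>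

lemma mixed_area_std_triangle:
  assumes K: "convex_body K"
  shows "mixed_area K (std_triangle 1) = support K (e1 + e2) + support K (- e1) + support K (- e2)"
proof -
  \<comment> \<open>The half of the unit square above the diagonal from \<open>(1, 0)\<close> to
    \<open>(0, 1)\<close>.\<close>
  define T where "T = (+) (vector [1, 1]) ` uminus ` std_triangle 1"
  let ?Q = "cbox 0 (vector [1, 1]) :: (real ^ 2) set"
  have T: "x \<in> T \<longleftrightarrow> x $ 1 \<le> 1 \<and> x $ 2 \<le> 1 \<and> 1 \<le> x $ 1 + x $ 2" for x
  proof -
    have "x \<in> T \<longleftrightarrow> - (x - vector [1, 1]) \<in> std_triangle 1"
      unfolding T_def mem_translation by (metis (no_types) image_iff minus_minus)
    then show ?thesis by (auto simp: std_triangle_def)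
  qed
  have b: "convex_body (std_triangle 1)" "convex_body T"
    by (simp_all add: T_def convex_body_translation convex_body_linear_image linear_uminus convex_body_std_triangle)
  have U: "std_triangle 1 \<union> T = ?Q"
    by (auto simp: T std_triangle_def mem_cbox_2)
  have I: "std_triangle 1 \<inter> T = (+) e1 ` closed_segment 0 (vector [-1, 1])"
  proof (intro set_eqI iffI)
    fix x assume "x \<in> std_triangle 1 \<inter> T"
    then have "x - e1 \<in> closed_segment 0 (vector [-1, 1])"
      by (auto simp: T std_triangle_def in_segment vec2_eq_iff intro!: exI[of _ "x $ 2"])
    then show "x \<in> (+) e1 ` closed_segment 0 (vector [-1, 1])" by (simp add: mem_translation)
  qed (auto simp: T std_triangle_def in_segment)
  have "mixed_area K ?Q + mixed_area K (closed_segment 0 (vector [-1, 1])) =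
    mixed_area K (std_triangle 1) + mixed_area K T"
    using mixed_area_valuation[OF K b] unfolding U I by (simp add: mixed_area_translation)
  moreover have "mixed_area K T = mixed_area (uminus ` K) (std_triangle 1)"
    using K b by (simp add: T_def mixed_area_translation mixed_area_uminus)
  moreover have "mixed_area (uminus ` K) (std_triangle 1) \<le> support K (- (e1 + e2)) + support K e1 + support K e2"
  proof -
    have "support (uminus ` K) u = support K (- u)" for u by (rule support_image) simp
    then show ?thesis
      using mixed_area_std_triangle_le[of "uminus ` K"] K by (simp add: convex_body_linear_image linear_uminus)
  qed
  moreover have "rot (vector [-1, 1]) = - (e1 + e2)" by (simp add: vec2_eq_iff)
  \<comment> \<open>The square and its diagonal together contribute the support values at
    \<open>e1\<close>, \<open>e2\<close>, \<open>e1 + e2\<close> and their negatives, which is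
    exactly the sum of the two upper bounds; so neither bound is strict.\<close>
  ultimately show ?thesis
    using mixed_area_std_triangle_le[OF K]
    by (simp add: mixed_area_rectangle mixed_area_segment K add.commute[of e2 e1])
qed

text \<open>The basis \<open>a\<close>, \<open>b\<close> carries the standard triangle to this one.
  The three vectors on the right are the edges turned into outer normals, for the orientation fixed
  by the sign of the determinant.\<close>

lemma mixed_area_triangle:
  assumes K: "convex_body K" and D: "0 < a $ 1 * b $ 2 - a $ 2 * b $ 1"
  shows "mixed_area K (convex hull {0, a, b}) =
    support K (rot (a - b)) + support K (rot b) + support K (- rot a)"
proof -
  let ?D = "a $ 1 * b $ 2 - a $ 2 * b $ 1"
  obtain K' where K': "convex_body K'"
    "mixed_area K ((\<lambda>x. x $ 1 *\<^sub>R a + x $ 2 *\<^sub>R b) ` std_triangle 1) = ?D * mixed_area K' (std_triangle 1)"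
    "\<And>u. ?D * support K' u = support K (u $ 2 *\<^sub>R rot a - u $ 1 *\<^sub>R rot b)"
    using mixed_area_change_basis[OF K convex_body_std_triangle[of 1] refl D] by auto
  have "linear (\<lambda>x :: real ^ 2. x $ 1 *\<^sub>R a + x $ 2 *\<^sub>R b)" by (intro linearI) (simp_all add: algebra_simps)
  from convex_hull_linear_image[OF this, of "{0, vector [1, 0], vector [0, 1]}"]
  have "(\<lambda>x. x $ 1 *\<^sub>R a + x $ 2 *\<^sub>R b) ` std_triangle 1 = convex hull {0, a, b}"
    by (simp add: std_triangle_eq_hull)
  moreover have "rot (a - b) = rot a - rot b" by (simp add: vec2_eq_iff)
  ultimately show ?thesis
    using K' by (simp add: mixed_area_std_triangle distrib_left)
qed

section \<open>Cutting points in convex position along a diagonal\<close>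

text \<open>The determinant of \<open>c - a\<close> and \<open>x - a\<close> vanishes, so
  \<open>x - a\<close> equals its projection to \<open>c - a\<close>, with coefficient
  \<open>?t\<close>.\<close>

lemma collinear_if_rot_orthogonal:
  assumes "a \<noteq> c" "rot (c - a) \<bullet> (x - a) = 0"
  shows "collinear {x, a, c}"
proof -
  let ?N = "(c - a) \<bullet> (c - a)" and ?t = "((c - a) \<bullet> (x - a)) / ((c - a) \<bullet> (c - a))"
  have "?N *\<^sub>R (x - a) = ((c - a) \<bullet> (x - a)) *\<^sub>R (c - a)"
    using assms(2) unfolding inner_2 rot_nth vec2_eq_iff vector_scaleR_component real_scaleR_def by algebra
  moreover have "?N \<noteq> 0" using assms(1) by simp
  ultimately have "x - a = ?t *\<^sub>R (c - a)" by (metis (no_types, lifting) divide_inverse_commute scaleR_one scaleR_scaleR left_inverse)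
  then have "collinear {0, c - a, x - a}" unfolding collinear_lemma by blast
  then show ?thesis using collinear_3[of c a x] by (simp add: insert_commute)
qed

text \<open>Of three collinear points one lies between the others, hence in the hull of the rest of
  \<open>S\<close>.\<close>

lemma convex_independent_not_collinear:
  assumes indep: "\<And>a. a \<in> S \<Longrightarrow> a \<notin> convex hull (S - {a})"
    and "x \<in> S" "y \<in> S" "z \<in> S" "x \<noteq> y" "x \<noteq> z" "y \<noteq> z"
  shows "rot (y - x) \<bullet> (z - x) \<noteq> 0"
proof
  assume "rot (y - x) \<bullet> (z - x) = 0"
  then have "collinear {z, x, y}" using assms by (intro collinear_if_rot_orthogonal)
  moreover have "\<not> between (p, q) r" if "p \<in> S" "q \<in> S" "r \<in> S" "p \<noteq> r" "q \<noteq> r" for p q r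
    using indep[of r] that hull_mono[of "{p, q}" "S - {r}" convex]
    by (auto simp: between_mem_convex_hull)
  ultimately show False using assms(2-) unfolding collinear_between_cases by metis
qed

text \<open>\<open>A\<close> and \<open>B\<close> are spanned by the points of \<open>S\<close> on
  either side of the line through \<open>a\<close> and \<open>c\<close>. That line meets the hull of
  \<open>S\<close> only in the diagonal, which lies in both parts.\<close>

lemma convex_hull_cut:
  assumes "finite S" and indep: "\<And>a. a \<in> S \<Longrightarrow> a \<notin> convex hull (S - {a})"
    and "a \<in> S" "c \<in> S" "a \<noteq> c"
    and "u = rot (c - a)"
  defines "A \<equiv> convex hull {s \<in> S. u \<bullet> a \<le> u \<bullet> s}" and "B \<equiv> convex hull {s \<in> S. u \<bullet> s \<le> u \<bullet> a}"
  shows "A \<union> B = convex hull S" "A \<inter> B = closed_segment a c"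
proof -
  have uc: "u \<bullet> c = u \<bullet> a" using assms by (simp add: inner_2 algebra_simps)
  have "convex A" "convex B" unfolding A_def B_def by auto
  have ac: "a \<in> A" "c \<in> A" "a \<in> B" "c \<in> B"
    unfolding A_def B_def using assms(3,4) uc by (auto intro!: hull_inc)
  then have seg: "closed_segment a c \<subseteq> A" "closed_segment a c \<subseteq> B"
    using \<open>convex A\<close> \<open>convex B\<close> by (simp_all add: closed_segment_subset)
  have "A \<subseteq> {x. u \<bullet> a \<le> u \<bullet> x}" "B \<subseteq> {x. u \<bullet> x \<le> u \<bullet> a}"
    unfolding A_def B_def
    by (rule hull_minimal; auto intro: convex_halfspace_ge convex_halfspace_le)+
  have sub: "A \<subseteq> convex hull S" "B \<subseteq> convex hull S"
    unfolding A_def B_def by (auto intro!: hull_mono)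
  have extr: "a extreme_point_of (convex hull S)" "c extreme_point_of (convex hull S)"
    using extreme_point_of_convex_hull_convex_independent[of S] assms(1,3,4) indep
    by (auto simp: finite_imp_compact)
  \<comment> \<open>A point of the hull on the line but beyond \<open>a\<close> or \<open>c\<close>
    would put that extreme point strictly inside a segment of the hull.\<close>
  have line: "x \<in> closed_segment a c" if "x \<in> convex hull S" "u \<bullet> x = u \<bullet> a" for x
  proof -
    have "collinear {x, a, c}"
      using that assms by (intro collinear_if_rot_orthogonal) (auto simp: inner_diff_right)
    then consider "x \<in> closed_segment a c" | "a \<in> closed_segment c x" | "c \<in> closed_segment x a"
      unfolding collinear_between_cases between_mem_segment by blast
    then show ?thesis
    proof cases
      case 2
      then have "a = c \<or> a = x"
        using extr that(1) assms(4) unfolding extreme_point_of_def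
        by (metis hull_inc insert_iff open_segment_def Diff_iff empty_iff)
      then show ?thesis using \<open>a \<noteq> c\<close> by auto
    next
      case 3
      then have "c = a \<or> c = x"
        using extr that(1) assms(3) unfolding extreme_point_of_def
        by (metis hull_inc insert_iff open_segment_def Diff_iff empty_iff)
      then show ?thesis using \<open>a \<noteq> c\<close> by auto
    qed auto
  qed
  show "A \<inter> B = closed_segment a c"
    using seg sub line \<open>A \<subseteq> {x. u \<bullet> a \<le> u \<bullet> x}\<close> \<open>B \<subseteq> {x. u \<bullet> x \<le> u \<bullet> a}\<close>
    by (auto intro!: line antisym)
  show "A \<union> B = convex hull S"
  proof
    show "convex hull S \<subseteq> A \<union> B"
    proof
      fix x assume x: "x \<in> convex hull S"
      let ?S1 = "{s \<in> S. u \<bullet> a \<le> u \<bullet> s}" and ?S2 = "{s \<in> S. u \<bullet> s \<le> u \<bullet> a}"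
      have "?S1 \<union> ?S2 = S" by auto
      then have "convex hull S = convex hull (A \<union> B)"
        unfolding A_def B_def by (metis hull_Un_left hull_Un_right)
      with x obtain s t y z where "0 \<le> s" "0 \<le> t" "s + t = 1" and yz: "y \<in> A" "z \<in> B"
        and "x = s *\<^sub>R y + t *\<^sub>R z"
        using convex_hull_union_two[of A B] \<open>convex A\<close> \<open>convex B\<close> ac by blast
      then have x': "x \<in> closed_segment y z"
        by (auto simp: in_segment intro!: exI[of _ t])
      \<comment> \<open>The segment from \<open>y\<close> to \<open>z\<close> crosses the line at
        \<open>w\<close>. As \<open>w\<close> is in the hull it is on the diagonal, hence in
        \<open>A\<close> and \<open>B\<close>, and it splits the segment into a piece in
        \<open>A\<close> and a piece in \<open>B\<close>.\<close>
      obtain w where w: "w \<in> closed_segment y z" "u \<bullet> w = u \<bullet> a"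
        using connected_ivt_hyperplane[of "closed_segment y z" z y u "u \<bullet> a"] yz
          \<open>A \<subseteq> {x. u \<bullet> a \<le> u \<bullet> x}\<close> \<open>B \<subseteq> {x. u \<bullet> x \<le> u \<bullet> a}\<close> by auto
      have "w \<in> convex hull S"
        using w(1) yz sub closed_segment_subset[of y "convex hull S" z] by auto
      with w line seg have "w \<in> A" "w \<in> B" by auto
      then have "closed_segment y w \<subseteq> A" "closed_segment w z \<subseteq> B"
        using yz \<open>convex A\<close> \<open>convex B\<close> by (simp_all add: closed_segment_subset)
      then show "x \<in> A \<union> B" using x' Un_closed_segment[OF w(1)] by auto
    qed
  qed (use sub in auto)
qed

text \<open>Seen from \<open>a\<close>, the signs of \<open>D\<close> form a tournament on
  \<open>b\<close>, \<open>c\<close>, \<open>d\<close>. Every tournament on three vertices has one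
  that wins against one and loses against another; this is \<open>p\<close>. The line through
  \<open>a\<close> and \<open>p\<close> then has points of \<open>S\<close> strictly on both
  sides.\<close>

lemma convex_independent_diagonal:
  assumes indep: "\<And>a. a \<in> S \<Longrightarrow> a \<notin> convex hull (S - {a})"
    and "a \<in> S" "b \<in> S" "c \<in> S" "d \<in> S" "distinct [a, b, c, d]"
  obtains p q r where "p \<in> S" "q \<in> S" "r \<in> S" "p \<noteq> a"
    "rot (p - a) \<bullet> q < rot (p - a) \<bullet> a" "rot (p - a) \<bullet> a < rot (p - a) \<bullet> r"
proof -
  define D where "D x y = rot (x - a) \<bullet> (y - a)" for x y
  have anti: "D y x = - D x y" for x y by (simp add: D_def inner_2 algebra_simps)
  have D: "D b c \<noteq> 0" "D b d \<noteq> 0" "D c d \<noteq> 0"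
    unfolding D_def by (rule convex_independent_not_collinear[OF indep]; use assms in auto)+
  have "\<exists>p\<in>{b, c, d}. (\<exists>q\<in>{b, c, d}. D p q < 0) \<and> (\<exists>r\<in>{b, c, d}. 0 < D p r)"
    using D anti[of b c] anti[of b d] anti[of c d]
    by (cases "D b c > 0"; cases "D b d > 0"; cases "D c d > 0"; force)
  then obtain p q r where "p \<in> {b, c, d}" "q \<in> {b, c, d}" "r \<in> {b, c, d}" "D p q < 0" "0 < D p r"
    by blast
  then show ?thesis
    using assms by (intro that[of p q r]) (auto simp: D_def inner_diff_right)
qed

section \<open>Integrality\<close>

lemma support_integral:
  assumes "lattice_polytope K" "\<And>i. u $ i \<in> \<int>"
  shows "support K u \<in> \<int>"
proof -
  obtain S where S: "finite S" "S \<noteq> {}" "\<And>x i. x \<in> S \<Longrightarrow> x $ i \<in> \<int>" "K = convex hull S"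
    using assms by (auto simp: lattice_polytope_def)
  have "Max ((\<lambda>x. u \<bullet> x) ` S) \<in> (\<lambda>x. u \<bullet> x) ` S" using S by simp
  then obtain x where "x \<in> S" "support K u = u \<bullet> x"
    using support_convex_hull[OF S(1,2)] unfolding S(4) by (metis imageE)
  then show ?thesis using S assms(2) by (simp add: inner_2)
qed

lemma lattice_polytope_body: "lattice_polytope K \<Longrightarrow> convex_body K"
  unfolding lattice_polytope_def using convex_body_convex_hull by blast

lemma rot_integral: "(\<And>i. v $ i \<in> \<int>) \<Longrightarrow> rot v $ i \<in> \<int>"
  using exhaust_2[of i] by auto

lemma mixed_area_integral_segment:
  assumes "lattice_polytope K" "\<And>i. a $ i \<in> \<int>" "\<And>i. b $ i \<in> \<int>"
  shows "mixed_area K (closed_segment a b) \<in> \<int>"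
proof -
  have "closed_segment a b = (+) a ` closed_segment 0 (b - a)"
    using closed_segment_translation[of a 0 "b - a"] by simp
  then show ?thesis
    using assms by (simp only: mixed_area_translation mixed_area_segment lattice_polytope_body)
      (auto intro!: Ints_add support_integral rot_integral Ints_diff simp: minus_in_Ints_iff)
qed

text \<open>After moving \<open>a\<close> to the origin and, if the orientation is negative,
  exchanging the other two vertices, the mixed area is a sum of support values of \<open>K\<close>
  at lattice vectors.\<close>

lemma mixed_area_integral_triangle:
  assumes "lattice_polytope K" "\<And>i. a $ i \<in> \<int>" "\<And>i. b $ i \<in> \<int>" "\<And>i. c $ i \<in> \<int>"
    and "rot (b - a) \<bullet> (c - a) \<noteq> 0"
  shows "mixed_area K (convex hull {a, b, c}) \<in> \<int>"
proof -
  have *: "mixed_area K (convex hull {0, v, w}) \<in> \<int>"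
    if "0 < v $ 1 * w $ 2 - v $ 2 * w $ 1" "\<And>i. v $ i \<in> \<int>" "\<And>i. w $ i \<in> \<int>" for v w
    using that assms(1) by (simp only: mixed_area_triangle lattice_polytope_body)
      (auto intro!: Ints_add support_integral rot_integral Ints_diff simp: minus_in_Ints_iff)
  have "{a, b, c} = (+) a ` {0, b - a, c - a}" by auto
  then have "mixed_area K (convex hull {a, b, c}) = mixed_area K (convex hull {0, b - a, c - a})"
    by (simp only: convex_hull_translation mixed_area_translation)
  moreover have "{0, b - a, c - a} = {0, c - a, b - a}" by auto
  ultimately show ?thesis
    using *[of "b - a" "c - a"] *[of "c - a" "b - a"] assms
    by (cases "0 < rot (b - a) \<bullet> (c - a)") (auto simp: inner_2 Ints_diff algebra_simps)
qed

text \<open>Induction on the number of points that span the second polytope. A point in the hull of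
  the others is dropped; up to three points in convex position give a point, a segment or a
  triangle; four or more are cut along a diagonal.\<close>

lemma mixed_area_integral:
  assumes K: "lattice_polytope K" and L: "lattice_polytope L"
  shows "mixed_area K L \<in> \<int>"
proof -
  have "mixed_area K (convex hull S) \<in> \<int>" if "finite S" "S \<noteq> {}" "\<And>x i. x \<in> S \<Longrightarrow> x $ i \<in> \<int>" for S
    using that
  proof (induction "card S" arbitrary: S rule: less_induct)
    case less
    note S = less.prems
    show ?case
    proof (cases "\<exists>a\<in>S. a \<in> convex hull (S - {a})")
      case True
      then obtain a where a: "a \<in> S" "a \<in> convex hull (S - {a})" by blast
      then have "convex hull S = convex hull (S - {a})"
        using hull_redundant[of a convex "S - {a}"] by (simp add: insert_absorb)
      moreover have "S - {a} \<noteq> {}" using a(2) by (metis convex_hull_empty empty_iff)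
      then have "mixed_area K (convex hull (S - {a})) \<in> \<int>"
        using a(1) S by (intro less.hyps card_Diff1_less) auto
      ultimately show ?thesis by simp
    next
      case False
      then have indep: "\<And>a. a \<in> S \<Longrightarrow> a \<notin> convex hull (S - {a})" by blast
      have "card S \<noteq> 0" using S by simp
      then consider "card S = 1" | "card S = 2" | "card S = 3" | "4 \<le> card S" by linarith
      then show ?thesis
      proof cases
        case 1
        then obtain a where "S = {a}" by (auto simp: card_1_singleton_iff)
        then show ?thesis by (simp add: mixed_area_singleton)
      next
        case 2
        then obtain a b where "S = {a, b}" by (auto simp: card_2_iff)
        then show ?thesis
          using S mixed_area_integral_segment[OF K, of a b] by (simp add: segment_convex_hull)
      next
        case 3
        then obtain a b c where "S = {a, b, c}" "a \<noteq> b" "a \<noteq> c" "b \<noteq> c" by (auto simp: card_3_iff)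
        then show ?thesis
          using S convex_independent_not_collinear[OF indep, of a b c]
          by (intro mixed_area_integral_triangle[OF K, of a b c, folded \<open>S = {a, b, c}\<close>]) auto
      next
        case 4
        then obtain T where "T \<subseteq> S" "card T = 4" by (meson obtain_subset_with_card_n)
        then obtain xs where xs: "set xs = T" "distinct xs" "length xs = 4"
          by (metis card.infinite distinct_card finite_distinct_list zero_neq_numeral)
        then obtain a b c d where "xs = [a, b, c, d]"
          by (auto simp: numeral_eq_Suc length_Suc_conv)
        then have abcd: "a \<in> S" "b \<in> S" "c \<in> S" "d \<in> S" "distinct [a, b, c, d]"
          using xs \<open>T \<subseteq> S\<close> by auto
        from convex_independent_diagonal[OF indep abcd]
        obtain p q r where pqr: "p \<in> S" "q \<in> S" "r \<in> S" "p \<noteq> a"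
          "rot (p - a) \<bullet> q < rot (p - a) \<bullet> a" "rot (p - a) \<bullet> a < rot (p - a) \<bullet> r" by metis
        let ?S1 = "{s \<in> S. rot (p - a) \<bullet> a \<le> rot (p - a) \<bullet> s}"
        let ?S2 = "{s \<in> S. rot (p - a) \<bullet> s \<le> rot (p - a) \<bullet> a}"
        \<comment> \<open>\<open>q\<close> and \<open>r\<close> lie strictly on opposite sides of
          the diagonal, so each part has fewer points than \<open>S\<close>.\<close>
        have "q \<notin> ?S1" "r \<notin> ?S2" using pqr by auto
        then have "?S1 \<subset> S" "?S2 \<subset> S" using \<open>q \<in> S\<close> \<open>r \<in> S\<close> by blast+
        then have "card ?S1 < card S" "card ?S2 < card S" using S by (simp_all add: psubset_card_mono)
        moreover have ne: "?S1 \<noteq> {}" "?S2 \<noteq> {}" using \<open>a \<in> S\<close> by auto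
        ultimately have "mixed_area K (convex hull ?S1) \<in> \<int>" "mixed_area K (convex hull ?S2) \<in> \<int>"
          using S(1,3) by (intro less.hyps; simp)+
        moreover have "mixed_area K (closed_segment a p) \<in> \<int>"
          using S pqr abcd by (intro mixed_area_integral_segment K) auto
        moreover note cut = convex_hull_cut[OF S(1) indep \<open>a \<in> S\<close> \<open>p \<in> S\<close> not_sym[OF \<open>p \<noteq> a\<close>] refl]
        have "mixed_area K (convex hull S) + mixed_area K (closed_segment a p) =
            mixed_area K (convex hull ?S1) + mixed_area K (convex hull ?S2)"
          using mixed_area_valuation[of K "convex hull ?S1" "convex hull ?S2"] K S(1) ne
          by (simp add: cut lattice_polytope_body convex_body_convex_hull)
        then have "mixed_area K (convex hull S) = mixed_area K (convex hull ?S1)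
            + mixed_area K (convex hull ?S2) - mixed_area K (closed_segment a p)" by simp
        ultimately show ?thesis by simp
      qed
    qed
  qed
  with L show ?thesis by (auto simp: lattice_polytope_def)
qed

section \<open>Non-negativity\<close>

lemma mixed_area_nonneg:
  assumes K: "convex_body K" and L: "convex_body L"
  shows "0 \<le> mixed_area K L"
proof -
  \<comment> \<open>The translates of \<open>K\<close> and \<open>L\<close> inside \<open>K + L\<close> overlap only in a vertical line.\<close>
  obtain p where p: "p \<in> K" "\<And>x. x \<in> K \<Longrightarrow> x $ 1 \<le> p $ 1"
  proof -
    obtain x where "x \<in> K" "\<And>y. y \<in> K \<Longrightarrow> e1 \<bullet> y \<le> e1 \<bullet> x"
      using support_attained[OF K, of e1] by metis
    then show ?thesis by (intro that[of x]) (auto simp: inner_2)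
  qed
  obtain q where q: "q \<in> L" "\<And>x. x \<in> L \<Longrightarrow> q $ 1 \<le> x $ 1"
  proof -
    obtain x where "x \<in> L" "\<And>y. y \<in> L \<Longrightarrow> - e1 \<bullet> y \<le> - e1 \<bullet> x"
      using support_attained[OF L, of "- e1"] by metis
    then show ?thesis by (intro that[of x]) (auto simp: inner_2)
  qed
  \<comment> \<open>With \<open>p\<close> rightmost in \<open>K\<close> and \<open>q\<close>
    leftmost in \<open>L\<close>, the first translate lies to the left of the line
    \<open>x $ 1 = p $ 1 + q $ 1\<close> and the second to its right.\<close>
  let ?A = "(+) q ` K" and ?B = "(+) p ` L"
  have m: "?A \<in> lmeasurable" "?B \<in> lmeasurable"
    using K L by (simp_all add: convex_body_translation convex_body_lmeasurable)
  have "?A \<inter> ?B \<subseteq> {x. e1 \<bullet> x = p $ 1 + q $ 1}"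
  proof
    fix x assume "x \<in> ?A \<inter> ?B"
    then have "x - q \<in> K" "x - p \<in> L" by (auto simp: mem_translation)
    from p(2)[OF this(1)] q(2)[OF this(2)] show "x \<in> {x. e1 \<bullet> x = p $ 1 + q $ 1}" by (simp add: inner_2)
  qed
  then have "negligible (?A \<inter> ?B)"
    by (rule negligible_subset[OF negligible_hyperplane, rotated]) (simp add: axis_eq_0_iff)
  then have "measure lebesgue K + measure lebesgue L = measure lebesgue (?A \<union> ?B)"
    using measure_Un_Int[OF m] by (simp add: measure_translation negligible_imp_measure0)
  also have "\<dots> \<le> measure lebesgue (K + L)"
  proof -
    have "q + k \<in> K + L" if "k \<in> K" for k
      using set_plus_intro[OF that q(1)] by (simp add: add.commute)
    then have "?A \<union> ?B \<subseteq> K + L" using p(1) by auto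
    then show ?thesis
      using m by (intro measure_mono_fmeasurable convex_body_lmeasurable convex_body_plus K L) auto
  qed
  finally show ?thesis by (simp add: mixed_area_eq)
qed

section \<open>Realizing prescribed mixed areas\<close>

text \<open>For \<open>b > 0\<close> the order enters twice: \<open>t < b \<le> a\<close> makes
  \<open>(0, a)\<close> a highest vertex of the triangle, so its height is \<open>a\<close>; and on
  its vertices the determinant against \<open>(-1, b)\<close> takes the values \<open>0\<close>,
  \<open>-a\<close>, \<open>-c\<close>, a range of length \<open>c\<close> because
  \<open>a \<le> c\<close>.\<close>

lemma mixed_areas_realizable_sorted:
  assumes "0 \<le> b" "b \<le> a" "a \<le> (c :: int)"
  shows "\<exists>P1 P2 P3. lattice_polytope P1 \<and> lattice_polytope P2 \<and> lattice_polytope P3 \<and>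
    of_int a = mixed_area P1 P2 \<and> of_int b = mixed_area P1 P3 \<and> of_int c = mixed_area P2 P3"
proof -
  have support_seg: "support (closed_segment 0 v) u = max 0 (u \<bullet> v)" for u v
    by (simp add: segment_convex_hull support_convex_hull)
  have lattice_seg: "lattice_polytope (closed_segment 0 v)" if "\<And>i. v $ i \<in> \<int>" for v
    unfolding lattice_polytope_def using that
    by (intro exI[of _ "{0, v}"]) (auto simp: segment_convex_hull)
  have vec_int: "(vector [x, y] :: real ^ 2) $ i \<in> \<int>" if "x \<in> \<int>" "y \<in> \<int>" for x y i
    using exhaust_2[of i] that by auto
  show ?thesis
  proof (cases "b = 0")
    case True
    \<comment> \<open>Parallel segments have mixed area zero; the vertical unit segment measures
      their lengths \<open>a\<close> and \<open>c\<close>.\<close>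
    let ?P1 = "closed_segment 0 (vector [of_int a, 0])" and ?P2 = "closed_segment 0 (vector [0, 1])"
      and ?P3 = "closed_segment 0 (vector [of_int c, 0])"
    have "mixed_area ?P1 ?P2 = of_int a" "mixed_area ?P1 ?P3 = 0" "mixed_area ?P3 ?P2 = of_int c"
      using assms by (simp_all add: mixed_area_segment support_seg inner_2)
    then show ?thesis
      using True mixed_area_commute[of ?P3 ?P2]
      by (intro exI[of _ ?P1] exI[of _ ?P2] exI[of _ ?P3]) (auto intro!: lattice_seg vec_int)
  next
    case False
    \<comment> \<open>Division with remainder gives \<open>(s, t)\<close> the determinant
      \<open>-c\<close> against \<open>(-1, b)\<close> while keeping its height below
      \<open>b\<close>.\<close>
    define s where "s = c div b"
    define t where "t = c mod b"
    have "0 < b" using assms(1) False by simp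
    then have t: "0 \<le> t" "t < b" "c = s * b + t" by (simp_all add: s_def t_def)
    let ?P1 = "closed_segment 0 (vector [1, 0])" and ?P3 = "closed_segment 0 (vector [-1, of_int b])"
      and ?P2 = "convex hull {0, vector [0, of_int a], vector [of_int s, of_int t]} :: (real ^ 2) set"
    have P2: "lattice_polytope ?P2"
      unfolding lattice_polytope_def
      by (intro exI[of _ "{0, vector [0, of_int a], vector [of_int s, of_int t]}"])
        (auto intro!: vec_int)
    have c: "real_of_int c = s * b + t" using t(3) by simp
    have "0 \<le> a" "0 \<le> c" "0 \<le> s * b"
      using assms \<open>0 < b\<close> by (auto simp: s_def pos_imp_zdiv_nonneg_iff)
    then have "0 \<le> real_of_int (s * b)" by linarith
    then have "0 \<le> real_of_int s * real_of_int b" by simp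
    moreover have "real_of_int a \<le> real_of_int s * real_of_int b + real_of_int t"
      using assms(3) t(3) by (simp flip: of_int_mult of_int_add)
    ultimately have "mixed_area ?P2 ?P1 = a" "mixed_area ?P2 ?P3 = c" "mixed_area ?P1 ?P3 = b"
      using assms t(1,2) \<open>0 \<le> a\<close> \<open>0 \<le> c\<close>
      by (simp_all add: mixed_area_segment support_seg support_convex_hull convex_body_convex_hull
          inner_2 c max_def algebra_simps)
    then show ?thesis
      using P2 mixed_area_commute[of ?P2 ?P1]
      by (intro exI[of _ ?P1] exI[of _ ?P2] exI[of _ ?P3]) (auto intro!: lattice_seg vec_int)
  qed
qed

text \<open>Relabelling the polytopes permutes the three values, and the exchanges of
  \<open>P1\<close> with \<open>P2\<close> and of \<open>P2\<close> with \<open>P3\<close> generate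
  all permutations. So the smallest value may be moved to the pair \<open>P1\<close>,
  \<open>P3\<close> and the largest to \<open>P2\<close>, \<open>P3\<close>.\<close>

lemma mixed_areas_realizable:
  assumes "0 \<le> x" "0 \<le> y" "0 \<le> (z :: int)"
  shows "\<exists>P1 P2 P3. lattice_polytope P1 \<and> lattice_polytope P2 \<and> lattice_polytope P3 \<and>
    of_int x = mixed_area P1 P2 \<and> of_int y = mixed_area P1 P3 \<and> of_int z = mixed_area P2 P3"
    (is "?R x y z")
proof -
  have swap: "?R x z y" "?R y x z" if R: "?R x y z" for x y z :: int
  proof -
    obtain P1 P2 P3 where P: "lattice_polytope P1" "lattice_polytope P2" "lattice_polytope P3"
      "of_int x = mixed_area P1 P2" "of_int y = mixed_area P1 P3" "of_int z = mixed_area P2 P3"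
      using R by blast
    show "?R x z y"
      using P by (intro exI[of _ P2] exI[of _ P1] exI[of _ P3]) (simp add: mixed_area_commute[of P2 P1])
    show "?R y x z"
      using P by (intro exI[of _ P1] exI[of _ P3] exI[of _ P2]) (simp add: mixed_area_commute[of P3 P2])
  qed
  have sorted: "?R a b c" if "0 \<le> b" "b \<le> a" "a \<le> c" for a b c :: int
    by (rule mixed_areas_realizable_sorted[OF that])
  consider "y \<le> x \<and> x \<le> z" | "x \<le> y \<and> y \<le> z" | "z \<le> x \<and> x \<le> y" | "x \<le> z \<and> z \<le> y"
    | "y \<le> z \<and> z \<le> x" | "z \<le> y \<and> y \<le> x" by linarith
  then show ?thesis
  proof cases
    case 1 show ?thesis by (rule sorted) (use 1 assms in auto)
  next
    case 2 show ?thesis by (rule swap(2), rule sorted) (use 2 assms in auto)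
  next
    case 3 show ?thesis by (rule swap(1), rule sorted) (use 3 assms in auto)
  next
    case 4 show ?thesis by (rule swap(1), rule swap(2), rule sorted) (use 4 assms in auto)
  next
    case 5 show ?thesis by (rule swap(1), rule swap(2), rule swap(1), rule sorted) (use 5 assms in auto)
  next
    case 6 show ?thesis by (rule swap(2), rule swap(1), rule sorted) (use 6 assms in auto)
  qed
qed

section \<open>The set of polynomials for three polytopes\<close>

lemma Vsf2_3: "Vsf2 3 = {Cst (mixed_area P1 P2) * Var 1 * Var 2 + Cst (mixed_area P1 P3) * Var 1 * Var 3
    + Cst (mixed_area P2 P3) * Var 2 * Var 3 | P1 P2 P3.
    lattice_polytope P1 \<and> lattice_polytope P2 \<and> lattice_polytope P3}"
proof -
  have pairs: "{(i, j). 1 \<le> i \<and> i < j \<and> j \<le> 3} = {(1, 2), (1, 3), (2, 3 :: nat)}" by auto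
  have idx: "{1..3} = {1, 2, 3 :: nat}" by auto
  show ?thesis
    unfolding Vsf2_def pairs idx
  proof (intro equalityI subsetI)
    fix f assume "f \<in> {Cst (mixed_area P1 P2) * Var 1 * Var 2 + Cst (mixed_area P1 P3) * Var 1 * Var 3
      + Cst (mixed_area P2 P3) * Var 2 * Var 3 | P1 P2 P3.
      lattice_polytope P1 \<and> lattice_polytope P2 \<and> lattice_polytope P3}"
    then obtain P1 P2 P3 where "lattice_polytope P1" "lattice_polytope P2" "lattice_polytope P3"
      "f = Cst (mixed_area P1 P2) * Var 1 * Var 2 + Cst (mixed_area P1 P3) * Var 1 * Var 3
      + Cst (mixed_area P2 P3) * Var 2 * Var 3" by blast
    then show "f \<in> {\<Sum>(i, j)\<in>{(1, 2), (1, 3), (2, 3)}. Cst (mixed_area (P i) (P j)) * Var i * Var j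
       | P :: nat \<Rightarrow> (real ^ 2) set. \<forall>i\<in>{1, 2, 3}. lattice_polytope (P i)}"
      \<comment> \<open>\<open>P3\<close> serves index 3 and is the default value at all indices
        other than 1 and 2.\<close>
      by (intro CollectI exI[of _ "(\<lambda>i. P3)(1 := P1, 2 := P2)"]) (simp add: add.assoc)
  next
    fix f assume "f \<in> {\<Sum>(i, j)\<in>{(1, 2), (1, 3), (2, 3)}. Cst (mixed_area (P i) (P j)) * Var i * Var j
       | P :: nat \<Rightarrow> (real ^ 2) set. \<forall>i\<in>{1, 2, 3}. lattice_polytope (P i)}"
    then obtain P :: "nat \<Rightarrow> (real ^ 2) set" where P: "\<forall>i\<in>{1, 2, 3}. lattice_polytope (P i)"
      "f = (\<Sum>(i, j)\<in>{(1, 2), (1, 3), (2, 3)}. Cst (mixed_area (P i) (P j)) * Var i * Var j)" by blast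
    then show "f \<in> {Cst (mixed_area P1 P2) * Var 1 * Var 2 + Cst (mixed_area P1 P3) * Var 1 * Var 3
      + Cst (mixed_area P2 P3) * Var 2 * Var 3 | P1 P2 P3.
      lattice_polytope P1 \<and> lattice_polytope P2 \<and> lattice_polytope P3}"
      by (intro CollectI exI[of _ "P 1"] exI[of _ "P 2"] exI[of _ "P 3"]) (simp add: add.assoc)
  qed
qed

theorem proposition3p1:
  shows "(\<forall>v12 v13 v23 :: int. 0 \<le> v12 \<and> 0 \<le> v13 \<and> 0 \<le> v23 \<longrightarrow>
            (\<exists>P1 P2 P3. lattice_polytope P1 \<and> lattice_polytope P2 \<and> lattice_polytope P3 \<and>
               of_int v12 = mixed_area P1 P2 \<and>
               of_int v13 = mixed_area P1 P3 \<and>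
               of_int v23 = mixed_area P2 P3)) \<and>
         Vsf2 3 =
           {Cst (of_int v12) * Var 1 * Var 2 + Cst (of_int v13) * Var 1 * Var 3
              + Cst (of_int v23) * Var 2 * Var 3
            | v12 v13 v23 :: int. 0 \<le> v12 \<and> 0 \<le> v13 \<and> 0 \<le> v23}"
proof
  show "Vsf2 3 = {Cst (of_int v12) * Var 1 * Var 2 + Cst (of_int v13) * Var 1 * Var 3
              + Cst (of_int v23) * Var 2 * Var 3
            | v12 v13 v23 :: int. 0 \<le> v12 \<and> 0 \<le> v13 \<and> 0 \<le> v23}" (is "_ = ?V")
  proof (intro equalityI subsetI)
    fix f assume "f \<in> ?V"
    then obtain v12 v13 v23 :: int where "0 \<le> v12" "0 \<le> v13" "0 \<le> v23"
      and f: "f = Cst (of_int v12) * Var 1 * Var 2 + Cst (of_int v13) * Var 1 * Var 3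
              + Cst (of_int v23) * Var 2 * Var 3" by blast
    then obtain P1 P2 P3 where "lattice_polytope P1" "lattice_polytope P2" "lattice_polytope P3"
      "of_int v12 = mixed_area P1 P2" "of_int v13 = mixed_area P1 P3" "of_int v23 = mixed_area P2 P3"
      using mixed_areas_realizable by metis
    then show "f \<in> Vsf2 3"
      unfolding Vsf2_3 f by (intro CollectI exI[of _ P1] exI[of _ P2] exI[of _ P3]) simp
  next
    \<comment> \<open>Integrality and non-negativity together turn the real coefficients of a member
      of \<open>Vsf2 3\<close> into non-negative integers.\<close>
    have int: "\<exists>v :: int. 0 \<le> v \<and> mixed_area P Q = of_int v"
      if "lattice_polytope P" "lattice_polytope Q" for P Q
      using mixed_area_integral[OF that] mixed_area_nonneg[of P Q] that
      by (metis Ints_cases lattice_polytope_body of_int_0_le_iff)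
    fix f assume "f \<in> Vsf2 3"
    then obtain P1 P2 P3 where P: "lattice_polytope P1" "lattice_polytope P2" "lattice_polytope P3"
      and f: "f = Cst (mixed_area P1 P2) * Var 1 * Var 2 + Cst (mixed_area P1 P3) * Var 1 * Var 3
        + Cst (mixed_area P2 P3) * Var 2 * Var 3"
      unfolding Vsf2_3 by blast
    obtain u v w :: int where "0 \<le> u" "mixed_area P1 P2 = of_int u" "0 \<le> v" "mixed_area P1 P3 = of_int v"
      "0 \<le> w" "mixed_area P2 P3 = of_int w"
      using int P by metis
    then show "f \<in> ?V"
      unfolding f by (intro CollectI exI[of _ u] exI[of _ v] exI[of _ w]) simp
  qed
qed (intro allI impI mixed_areas_realizable; simp)

end
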